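(* Let $\nu_1:L_{\mathrm d}^2\to\mathbb R$ be $L$-smooth, and let $\nu_2,\nu_3:L_{\mathrm d}^2\to\mathbb R$ be $\mu_2$-strongly convex and $\mu_3$-strongly convex, respectively, with $\mu_2\ge 0$. Let $\Delta t>0$. Then the scheme $$\frac{U^{(n+1)}-U^{(n)}}{\Delta t}=-\left\{\nabla_{L_{\mathrm d}^2}\nu_1(U^{(n)})+\nabla_{L_{\mathrm d}^2}\nu_2(U^{(n+1)})-\nabla_{L_{\mathrm d}^2}\nu_3(U^{(n)})\right\}$$ admits a unique solution at each time step; that is, for every $U^{(n)}\in L_{\mathrm d}^2$ there exists exactly one $U^{(n+1)}\in L_{\mathrm d}^2$ satisfying this equation.
   Context: Fix lengths $\ell_x,\ell_y,\ell_z>0$, positive integers $N_x,N_y,N_z$, and mesh sizes $\Delta x=\ell_x/N_x$, $\Delta y=\ell_y/N_y$, $\Delta z=\ell_z/N_z$. $L_{\mathrm d}^2$ is the real vector space of arrays $f=(f_{i,j,k})$ with $0\le i\le N_x$, $0\le j\le N_y$, $0\le k\le N_z$. It carries the inner product $\langle f,g\rangle_{L_{\mathrm d}^2}=\sum''_{i}\sum''_{j}\sum''_{k}f_{i,j,k}g_{i,j,k}\,\Delta x\Delta y\Delta z$, where $\sum''_{i=0}^{N}a_i=\frac{a_0}{2}+a_1+\dots+a_{N-1}+\frac{a_N}{2}$, and the norm $\|f\|_{L_{\mathrm d}^2}=\langle f,f\rangle_{L_{\mathrm d}^2}^{1/2}$. Gradient: for $\nu:L_{\mathrm d}^2\to\mathbb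 R$ and $f\in L_{\mathrm d}^2$, if $\lim_{\Lambda\to+0}\frac{\nu(f+\Lambda h)-\nu(f)}{\Lambda}$ exists for all $h$ and is linear and continuous in $h$, then $\nabla_{L_{\mathrm d}^2}\nu(f)\in L_{\mathrm d}^2$ is the unique element with $\lim_{\Lambda\to+0}\frac{\nu(f+\Lambda h)-\nu(f)}{\Lambda}=\langle\nabla_{L_{\mathrm d}^2}\nu(f),h\rangle_{L_{\mathrm d}^2}$ for all $h$. $\nu$ is $L$-smooth ($L>0$) if its gradient exists everywhere and $\|\nabla_{L_{\mathrm d}^2}\nu(f)-\nabla_{L_{\mathrm d}^2}\nu(g)\|_{L_{\mathrm d}^2}\le L\|f-g\|_{L_{\mathrm d}^2}$ for all $f,g$. $\nu$ is $\mu$-strongly convex ($\mu\in\mathbb R$) if its gradient exists everywhere and $\nu(g)\ge\nu(f)+\langle\nabla_{L_{\mathrm d}^2}\nu(f),g-f\rangle_{L_{\mathrm d}^2}+\frac{\mu}{2}\|g-f\|_{L_{\mathrm d}^2}^2$ for all $f,g$. *)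

theory Defs
  imports Complex_Main "HOL-Library.Function_Algebras"
begin

record grid =
  len_x :: real
  len_y :: real
  len_z :: real
  num_x :: nat
  num_y :: nat
  num_z :: nat

definition grid_ok :: "grid \<Rightarrow> bool" where
  "grid_ok G \<longleftrightarrow> len_x G > 0 \<and> len_y G > 0 \<and> len_z G > 0 \<and>
     num_x G > 0 \<and> num_y G > 0 \<and> num_z G > 0"

definition mesh_x :: "grid \<Rightarrow> real" where "mesh_x G = len_x G / real (num_x G)"
definition mesh_y :: "grid \<Rightarrow> real" where "mesh_y G = len_y G / real (num_y G)"
definition mesh_z :: "grid \<Rightarrow> real" where "mesh_z G = len_z G / real (num_z G)"

type_synonym arr = "nat \<Rightarrow> nat \<Rightarrow> nat \<Rightarrow> real"

text \<open>An array on the index box is encoded as a function that is \<open>0\<close> outside the box, so that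
  equality of arrays is equality of functions and the set is closed under the pointwise operations
  (\<open>+\<close>, \<open>-\<close> are those of \<open>Function_Algebras\<close>).\<close>

definition Ld2 :: "grid \<Rightarrow> arr set" where
  "Ld2 G = {f. \<forall>i j k. \<not> (i \<le> num_x G \<and> j \<le> num_y G \<and> k \<le> num_z G) \<longrightarrow> f i j k = 0}"

definition arr_scale :: "real \<Rightarrow> arr \<Rightarrow> arr" (infixr "\<cdot>\<^sub>a" 75) where
  "c \<cdot>\<^sub>a f = (\<lambda>i j k. c * f i j k)"

definition trap_sum :: "nat \<Rightarrow> (nat \<Rightarrow> real) \<Rightarrow> real" where
  "trap_sum N a = a 0 / 2 + (\<Sum>i\<in>{0<..<N}. a i) + a N / 2"

definition Ld2_inner :: "grid \<Rightarrow> arr \<Rightarrow> arr \<Rightarrow> real" where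
  "Ld2_inner G f g =
     trap_sum (num_x G) (\<lambda>i. trap_sum (num_y G) (\<lambda>j. trap_sum (num_z G) (\<lambda>k.
       f i j k * g i j k * mesh_x G * mesh_y G * mesh_z G)))"

definition Ld2_norm :: "grid \<Rightarrow> arr \<Rightarrow> real" where
  "Ld2_norm G f = sqrt (Ld2_inner G f f)"

definition Ld2_linear :: "grid \<Rightarrow> (arr \<Rightarrow> real) \<Rightarrow> bool" where
  "Ld2_linear G D \<longleftrightarrow>
     (\<forall>g\<in>Ld2 G. \<forall>h\<in>Ld2 G. D (g + h) = D g + D h) \<and>
     (\<forall>c. \<forall>h\<in>Ld2 G. D (c \<cdot>\<^sub>a h) = c * D h)"

definition Ld2_continuous :: "grid \<Rightarrow> (arr \<Rightarrow> real) \<Rightarrow> bool" where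
  "Ld2_continuous G D \<longleftrightarrow>
     (\<forall>h\<in>Ld2 G. \<forall>e>0. \<exists>d>0. \<forall>g\<in>Ld2 G. Ld2_norm G (g - h) < d \<longrightarrow> \<bar>D g - D h\<bar> < e)"

definition has_dir_deriv :: "(arr \<Rightarrow> real) \<Rightarrow> arr \<Rightarrow> arr \<Rightarrow> real \<Rightarrow> bool" where
  "has_dir_deriv \<nu> f h d \<longleftrightarrow> ((\<lambda>s. (\<nu> (f + s \<cdot>\<^sub>a h) - \<nu> f) / s) \<longlongrightarrow> d) (at_right 0)"

definition grad_exists :: "grid \<Rightarrow> (arr \<Rightarrow> real) \<Rightarrow> arr \<Rightarrow> bool" where
  "grad_exists G \<nu> f \<longleftrightarrow>
     (\<exists>D. (\<forall>h\<in>Ld2 G. has_dir_deriv \<nu> f h (D h)) \<and> Ld2_linear G D \<and> Ld2_continuous G D)"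

text \<open>Meaningful only when \<open>grid_ok G\<close>, \<open>f \<in> Ld2 G\<close> and \<open>grad_exists G \<nu> f\<close>; the element is then
  the Riesz representative of the directional derivative.\<close>

definition grad :: "grid \<Rightarrow> (arr \<Rightarrow> real) \<Rightarrow> arr \<Rightarrow> arr" where
  "grad G \<nu> f = (THE g. g \<in> Ld2 G \<and> (\<forall>h\<in>Ld2 G. has_dir_deriv \<nu> f h (Ld2_inner G g h)))"

text \<open>A functional on \<open>Ld2 G\<close> is a function on all of \<open>arr\<close>, of which only the values on \<open>Ld2 G\<close>
  are ever used.\<close>

definition L_smooth :: "grid \<Rightarrow> real \<Rightarrow> (arr \<Rightarrow> real) \<Rightarrow> bool" where
  "L_smooth G L \<nu> \<longleftrightarrow>
     (\<forall>f\<in>Ld2 G. grad_exists G \<nu> f) \<and>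
     (\<forall>f\<in>Ld2 G. \<forall>g\<in>Ld2 G. Ld2_norm G (grad G \<nu> f - grad G \<nu> g) \<le> L * Ld2_norm G (f - g))"

definition strongly_convex :: "grid \<Rightarrow> real \<Rightarrow> (arr \<Rightarrow> real) \<Rightarrow> bool" where
  "strongly_convex G \<mu> \<nu> \<longleftrightarrow>
     (\<forall>f\<in>Ld2 G. grad_exists G \<nu> f) \<and>
     (\<forall>f\<in>Ld2 G. \<forall>g\<in>Ld2 G.
        \<nu> g \<ge> \<nu> f + Ld2_inner G (grad G \<nu> f) (g - f) + \<mu> / 2 * (Ld2_norm G (g - f))\<^sup>2)"

end

theory Submission
  imports Defs
begin

text \<open>With \<open>W = U - \<Delta>t (\<nabla>\<nu>1(U) - \<nabla>\<nu>3(U))\<close>, the scheme says that the gradient of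
  \<open>F(V) = \<nu>2(V) + \<parallel>V - W\<parallel>\<^sup>2 / (2 \<Delta>t)\<close> vanishes at the new iterate. As \<open>\<mu>2 \<ge> 0\<close>, the
  functional \<open>F\<close> is strongly convex, so it is bounded below and any minimizing sequence is Cauchy; the
  gradient inequality at the limit shows that the limit is a minimizer. Uniqueness follows from
  monotonicity of \<open>\<nabla>\<nu>2\<close>.\<close>

section \<open>A Cauchy criterion for real sequences\<close>

text \<open>This is the form in which a minimizing sequence controls each of its cells: the squared
  distance of two members is bounded by the excesses of their values over the infimum, which are
  below \<open>1 / real (Suc n)\<close>.\<close>

lemma Cauchy_if_power2_diff_le:
  fixes x :: "nat \<Rightarrow> real"
  assumes "\<And>m n. (x m - x n)\<^sup>2 \<le> K * (1 / real (Suc m) + 1 / real (Suc n))" and "K > 0"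
  shows "Cauchy x"
proof (rule CauchyI)
  fix e :: real assume "e > 0"
  then have "e\<^sup>2 / (2 * K) > 0" using \<open>K > 0\<close> by simp
  then obtain M where M: "1 / real (Suc M) < e\<^sup>2 / (2 * K)"
    using nat_approx_posE by blast
  have "norm (x m - x n) < e" if "m \<ge> M" "n \<ge> M" for m n
  proof -
    have "1 / real (Suc m) \<le> 1 / real (Suc M)" "1 / real (Suc n) \<le> 1 / real (Suc M)"
      using that by (simp_all add: frac_le)
    then have "1 / real (Suc m) + 1 / real (Suc n) < e\<^sup>2 / K" using M by simp
    then have "K * (1 / real (Suc m) + 1 / real (Suc n)) < e\<^sup>2"
      using \<open>K > 0\<close> by (simp add: pos_less_divide_eq mult.commute)
    then have "(x m - x n)\<^sup>2 < e\<^sup>2" using assms(1)[of m n] by linarith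
    then show ?thesis using \<open>e > 0\<close> power2_less_imp_less[of "\<bar>x m - x n\<bar>" e] by simp
  qed
  then show "\<exists>M. \<forall>m\<ge>M. \<forall>n\<ge>M. norm (x m - x n) < e" by blast
qed

section \<open>The inner product as a weighted sum over the index box\<close>

definition trap_weight :: "nat \<Rightarrow> nat \<Rightarrow> real" where
  "trap_weight N i = (if i = 0 \<or> i = N then 1 / 2 else 1)"

text \<open>The two endpoints must be distinct: at \<open>N = 0\<close> both halves fall on the same
  index, so \<open>trap_sum\<close> yields \<open>a 0\<close> whereas the weighted sum yields
  \<open>a 0 / 2\<close>.\<close>

lemma trap_sum_eq_weighted_sum:
  assumes "N > 0"
  shows "trap_sum N a = (\<Sum>i\<le>N. trap_weight N i * a i)"
proof -
  have "{..N} = insert 0 (insert N {0<..<N})" using assms by auto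
  then have "(\<Sum>i\<le>N. trap_weight N i * a i) =
      a 0 / 2 + a N / 2 + (\<Sum>i\<in>{0<..<N}. trap_weight N i * a i)"
    using assms by (simp add: trap_weight_def)
  also have "(\<Sum>i\<in>{0<..<N}. trap_weight N i * a i) = (\<Sum>i\<in>{0<..<N}. a i)"
    by (rule sum.cong) (auto simp: trap_weight_def)
  finally show ?thesis by (simp add: trap_sum_def)
qed

definition grid_box :: "grid \<Rightarrow> (nat \<times> nat \<times> nat) set" where
  "grid_box G = {..num_x G} \<times> {..num_y G} \<times> {..num_z G}"

definition cell_weight :: "grid \<Rightarrow> nat \<Rightarrow> nat \<Rightarrow> nat \<Rightarrow> real" where
  "cell_weight G i j k = trap_weight (num_x G) i * trap_weight (num_y G) j *
     trap_weight (num_z G) k * (mesh_x G * mesh_y G * mesh_z G)"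

lemma finite_grid_box [simp]: "finite (grid_box G)"
  by (simp add: grid_box_def)

lemma Ld2_outside: "f \<in> Ld2 G \<Longrightarrow> (i, j, k) \<notin> grid_box G \<Longrightarrow> f i j k = 0"
  by (auto simp: Ld2_def grid_box_def)

lemma Ld2I: "(\<And>i j k. (i, j, k) \<notin> grid_box G \<Longrightarrow> f i j k = 0) \<Longrightarrow> f \<in> Ld2 G"
  by (auto simp: Ld2_def grid_box_def)

lemma cell_weight_pos: "grid_ok G \<Longrightarrow> cell_weight G i j k > 0"
  by (simp add: cell_weight_def trap_weight_def grid_ok_def mesh_x_def mesh_y_def mesh_z_def)

text \<open>Collapsing the three nested sums into one finite sum with positive weights reduces
  bilinearity, symmetry, definiteness and limits to facts about finite sums.\<close>

lemma Ld2_inner_eq_sum: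
  assumes "grid_ok G"
  shows "Ld2_inner G f g =
    (\<Sum>(i, j, k)\<in>grid_box G. cell_weight G i j k * (f i j k * g i j k))"
  using assms
  by (simp add: Ld2_inner_def trap_sum_eq_weighted_sum grid_ok_def grid_box_def cell_weight_def
      sum.cartesian_product sum_distrib_left case_prod_unfold mult_ac)

lemma Ld2_zero [simp]: "0 \<in> Ld2 G"
  and Ld2_add [intro]: "f \<in> Ld2 G \<Longrightarrow> g \<in> Ld2 G \<Longrightarrow> f + g \<in> Ld2 G"
  and Ld2_diff [intro]: "f \<in> Ld2 G \<Longrightarrow> g \<in> Ld2 G \<Longrightarrow> f - g \<in> Ld2 G"
  and Ld2_uminus [intro]: "f \<in> Ld2 G \<Longrightarrow> - f \<in> Ld2 G"
  and Ld2_scale [intro]: "f \<in> Ld2 G \<Longrightarrow> c \<cdot>\<^sub>a f \<in> Ld2 G"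
  by (auto simp: Ld2_def arr_scale_def)

lemma Ld2_linear_add:
    "Ld2_linear G D \<Longrightarrow> g \<in> Ld2 G \<Longrightarrow> h \<in> Ld2 G \<Longrightarrow> D (g + h) = D g + D h"
  and Ld2_linear_scale: "Ld2_linear G D \<Longrightarrow> h \<in> Ld2 G \<Longrightarrow> D (c \<cdot>\<^sub>a h) = c * D h"
  by (simp_all add: Ld2_linear_def)

section \<open>Inner product laws on a valid grid\<close>

context
  fixes G :: grid
  assumes ok: "grid_ok G"
begin

lemma Ld2_inner_add_left: "Ld2_inner G (f + g) h = Ld2_inner G f h + Ld2_inner G g h"
  by (simp add: Ld2_inner_eq_sum[OF ok] sum.distrib[symmetric] case_prod_unfold algebra_simps)

lemma Ld2_inner_scale_left: "Ld2_inner G (c \<cdot>\<^sub>a f) h = c * Ld2_inner G f h"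
  by (simp add: Ld2_inner_eq_sum[OF ok] arr_scale_def sum_distrib_left case_prod_unfold mult_ac)

lemma Ld2_inner_commute: "Ld2_inner G f g = Ld2_inner G g f"
  by (simp add: Ld2_inner_eq_sum[OF ok] mult.commute)

lemma Ld2_inner_uminus_left: "Ld2_inner G (- f) h = - Ld2_inner G f h"
proof -
  have "- f = (- 1) \<cdot>\<^sub>a f" by (simp add: arr_scale_def fun_eq_iff)
  then show ?thesis by (simp only: Ld2_inner_scale_left)
qed

lemma Ld2_inner_diff_left: "Ld2_inner G (f - g) h = Ld2_inner G f h - Ld2_inner G g h"
  using Ld2_inner_add_left[of f "- g" h] by (simp add: Ld2_inner_uminus_left)

lemmas Ld2_inner_left =
  Ld2_inner_add_left Ld2_inner_diff_left Ld2_inner_uminus_left Ld2_inner_scale_left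

lemma Ld2_inner_right:
  "Ld2_inner G h (f + g) = Ld2_inner G h f + Ld2_inner G h g"
  "Ld2_inner G h (f - g) = Ld2_inner G h f - Ld2_inner G h g"
  "Ld2_inner G h (- f) = - Ld2_inner G h f"
  "Ld2_inner G h (c \<cdot>\<^sub>a f) = c * Ld2_inner G h f"
  by (simp_all add: Ld2_inner_commute[of h] Ld2_inner_left)

text \<open>A single term of a sum of nonnegative terms is at most the sum. This passes from the
  norm to individual cells, both for definiteness and for the Cauchy property of a minimizing
  sequence.\<close>

lemma cell_le_Ld2_inner_self:
  assumes "(i, j, k) \<in> grid_box G"
  shows "cell_weight G i j k * (f i j k)\<^sup>2 \<le> Ld2_inner G f f"
  unfolding Ld2_inner_eq_sum[OF ok]
  using member_le_sum[OF assms, of "\<lambda>(i, j, k). cell_weight G i j k * (f i j k * f i j k)"]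
    less_imp_le[OF cell_weight_pos[OF ok]]
  by (auto simp: power2_eq_square)

lemma Ld2_inner_self_nonneg: "Ld2_inner G f f \<ge> 0"
  unfolding Ld2_inner_eq_sum[OF ok]
  by (rule sum_nonneg) (auto intro!: mult_nonneg_nonneg[OF less_imp_le[OF cell_weight_pos[OF ok]]])

lemma Ld2_inner_self_le_0_iff:
  assumes "f \<in> Ld2 G"
  shows "Ld2_inner G f f \<le> 0 \<longleftrightarrow> f = 0"
proof
  assume le: "Ld2_inner G f f \<le> 0"
  have "f i j k = 0" for i j k
  proof (cases "(i, j, k) \<in> grid_box G")
    case True
    then have "cell_weight G i j k * (f i j k)\<^sup>2 \<le> 0"
      using cell_le_Ld2_inner_self[of i j k f] le by linarith
    then show ?thesis using cell_weight_pos[OF ok, of i j k]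
      by (simp add: mult_le_0_iff)
  qed (use assms Ld2_outside in blast)
  then show "f = 0" by (simp add: fun_eq_iff)
qed (simp add: Ld2_inner_eq_sum[OF ok])

section \<open>Riesz representation and well-definedness of the gradient\<close>

text \<open>The indicator arrays of the cells form a basis, and \<open>D\<close> is evaluated on the
  expansion of \<open>h\<close> in it.\<close>

lemma Ld2_linear_eq_sum:
  assumes D: "Ld2_linear G D" and h: "h \<in> Ld2 G"
  shows "D h = (\<Sum>(i, j, k)\<in>grid_box G. h i j k * D (\<lambda>a b c. if (a, b, c) = (i, j, k) then 1 else 0))"
proof -
  let ?e = "\<lambda>(i, j, k) a b c. if (a, b, c) = (i, j, k) then 1 else (0 :: real)"
  \<comment> \<open>\<open>?r A\<close> is \<open>h\<close> cut off outside \<open>A\<close>.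
    Induction on \<open>A\<close> adds one cell at a time, until \<open>A\<close> is the whole box
    and the cut-off is \<open>h\<close> itself.\<close>
  let ?r = "\<lambda>A a b c. if (a, b, c) \<in> A then h a b c else 0"
  have D0: "D 0 = 0"
  proof -
    have "(0::real) \<cdot>\<^sub>a 0 = (0::arr)" by (simp add: arr_scale_def fun_eq_iff)
    then show ?thesis using Ld2_linear_scale[OF D Ld2_zero, of 0] by simp
  qed
  have "D (?r A) = (\<Sum>(i, j, k)\<in>A. h i j k * D (?e (i, j, k)))"
    if "finite A" "A \<subseteq> grid_box G" for A
    using that
  proof (induction A rule: finite_induct)
    case empty
    have "?r {} = 0" by (simp add: fun_eq_iff)
    then show ?case using D0 by simp
  next
    case (insert p A)
    obtain i j k where p: "p = (i, j, k)" by (cases p)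
    have e: "?e p \<in> Ld2 G" using insert.prems by (intro Ld2I) (auto simp: p)
    have r: "?r A \<in> Ld2 G" using insert.prems by (intro Ld2I) auto
    have "?r (insert p A) = h i j k \<cdot>\<^sub>a ?e p + ?r A"
      using insert.hyps by (auto simp: p arr_scale_def fun_eq_iff)
    then have "D (?r (insert p A)) = h i j k * D (?e p) + D (?r A)"
      by (simp only: Ld2_linear_add[OF D Ld2_scale[OF e] r] Ld2_linear_scale[OF D e])
    with insert show ?case by (simp add: p)
  qed
  from this[of "grid_box G"] have "D (?r (grid_box G)) =
      (\<Sum>(i, j, k)\<in>grid_box G. h i j k * D (?e (i, j, k)))" by simp
  moreover have "?r (grid_box G) = h"
    using Ld2_outside[OF h] by (auto simp: fun_eq_iff)
  ultimately show ?thesis by simp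
qed

text \<open>Dividing the value of \<open>D\<close> on a basis array by the weight of its cell
  cancels the weight in the inner product.\<close>

lemma Ld2_riesz:
  assumes D: "Ld2_linear G D"
  obtains g where "g \<in> Ld2 G" and "\<And>h. h \<in> Ld2 G \<Longrightarrow> D h = Ld2_inner G g h"
proof
  define g :: arr where "g = (\<lambda>i j k. if (i, j, k) \<in> grid_box G
      then D (\<lambda>a b c. if (a, b, c) = (i, j, k) then 1 else 0) / cell_weight G i j k else 0)"
  show "g \<in> Ld2 G" by (rule Ld2I) (simp add: g_def)
  fix h assume h: "h \<in> Ld2 G"
  have "cell_weight G i j k \<noteq> 0" for i j k
    using cell_weight_pos[OF ok, of i j k] by simp
  then show "D h = Ld2_inner G g h"
    unfolding Ld2_linear_eq_sum[OF D h] Ld2_inner_eq_sum[OF ok]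
    by (intro sum.cong) (auto simp: g_def)
qed

text \<open>Justifies the definite description in \<open>grad\<close>: the Riesz representative is a
  candidate, and any two candidates agree because a one-sided limit is unique. The direction
  \<open>g' - g\<close> turns this agreement into a vanishing norm.\<close>

lemma grad_properties:
  assumes "grad_exists G \<nu> f"
  shows grad_in_Ld2: "grad G \<nu> f \<in> Ld2 G"
    and has_dir_deriv_grad: "h \<in> Ld2 G \<Longrightarrow> has_dir_deriv \<nu> f h (Ld2_inner G (grad G \<nu> f) h)"
proof -
  let ?P = "\<lambda>g. g \<in> Ld2 G \<and> (\<forall>h\<in>Ld2 G. has_dir_deriv \<nu> f h (Ld2_inner G g h))"
  obtain D where D: "\<forall>h\<in>Ld2 G. has_dir_deriv \<nu> f h (D h)" "Ld2_linear G D"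
    using assms by (auto simp: grad_exists_def)
  obtain g where g: "g \<in> Ld2 G" "\<And>h. h \<in> Ld2 G \<Longrightarrow> D h = Ld2_inner G g h"
    using Ld2_riesz[OF D(2)] by blast
  have "\<exists>!g. ?P g"
  proof (rule ex1I)
    show "?P g" using D(1) g by simp
    fix g' assume g': "?P g'"
    have d: "g' - g \<in> Ld2 G" using g g' by blast
    have "has_dir_deriv \<nu> f (g' - g) (Ld2_inner G g' (g' - g))"
      "has_dir_deriv \<nu> f (g' - g) (Ld2_inner G g (g' - g))"
      using g' D(1) g(2)[OF d] d by auto
    then have "Ld2_inner G g' (g' - g) = Ld2_inner G g (g' - g)"
      unfolding has_dir_deriv_def by (rule tendsto_unique[OF trivial_limit_at_right_real])
    then have "Ld2_inner G (g' - g) (g' - g) \<le> 0" by (simp add: Ld2_inner_left)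
    then show "g' = g" using Ld2_inner_self_le_0_iff[OF d] by simp
  qed
  then have "?P (grad G \<nu> f)" unfolding grad_def by (rule theI')
  then show "grad G \<nu> f \<in> Ld2 G"
    and "h \<in> Ld2 G \<Longrightarrow> has_dir_deriv \<nu> f h (Ld2_inner G (grad G \<nu> f) h)" by auto
qed

section \<open>Minimizers of strongly convex functionals\<close>

text \<open>At the limit \<open>V\<close> of a minimizing sequence, the affine minorant of
  \<open>F\<close> with slope \<open>g V\<close> takes the place of lower semicontinuity.\<close>

lemma Ld2_strongly_convex_attains_min:
  fixes F :: "arr \<Rightarrow> real" and g :: "arr \<Rightarrow> arr"
  assumes c: "c > 0"
    and F: "\<And>a b. a \<in> Ld2 G \<Longrightarrow> b \<in> Ld2 G \<Longrightarrow>
      F a + Ld2_inner G (g a) (b - a) + c / 2 * Ld2_inner G (b - a) (b - a) \<le> F b"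
  obtains V where "V \<in> Ld2 G" and "\<And>h. h \<in> Ld2 G \<Longrightarrow> F V \<le> F h"
proof -
  define m where "m = Inf (F ` Ld2 G)"
  \<comment> \<open>Completing the square: the minorant at \<open>0\<close> is a quadratic in
    \<open>b\<close>, smallest where \<open>g 0 + c \<cdot>\<^sub>a b\<close> vanishes.\<close>
  have "F 0 - Ld2_inner G (g 0) (g 0) / (2 * c) \<le> F b" if b: "b \<in> Ld2 G" for b
  proof -
    have "0 \<le> Ld2_inner G (g 0 + c \<cdot>\<^sub>a b) (g 0 + c \<cdot>\<^sub>a b) / (2 * c)"
      using Ld2_inner_self_nonneg c by simp
    also have "\<dots> = Ld2_inner G (g 0) (g 0) / (2 * c) + Ld2_inner G (g 0) b + c / 2 * Ld2_inner G b b"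
      using c by (simp add: Ld2_inner_left Ld2_inner_right Ld2_inner_commute field_simps)
    finally show ?thesis using F[OF Ld2_zero b] by simp
  qed
  then have bdd: "bdd_below (F ` Ld2 G)" by (intro bdd_belowI2)
  have m_le: "m \<le> F b" if "b \<in> Ld2 G" for b
    unfolding m_def using that bdd by (intro cInf_lower) auto
  have "\<exists>a. a \<in> Ld2 G \<and> F a < m + 1 / real (Suc n)" for n
  proof -
    have "F ` Ld2 G \<noteq> {}" using Ld2_zero by blast
    moreover have "Inf (F ` Ld2 G) < m + 1 / real (Suc n)" by (simp add: m_def)
    ultimately have "\<exists>x\<in>F ` Ld2 G. x < m + 1 / real (Suc n)" by (rule cInf_lessD)
    then show ?thesis by auto
  qed
  then have "\<forall>n. \<exists>a. a \<in> Ld2 G \<and> F a < m + 1 / real (Suc n)" ..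
  from choice[OF this] obtain X
    where X: "\<And>n. X n \<in> Ld2 G" "\<And>n. F (X n) < m + 1 / real (Suc n)"
    by blast
  \<comment> \<open>The strong convexity inequality is applied at the midpoint \<open>p\<close>
    towards both members. The linear terms cancel and \<open>m \<le> F p\<close> remains; the factor
    4 appears because \<open>X n - X l\<close> is twice \<open>q\<close>.\<close>
  have X_close: "Ld2_inner G (X n - X l) (X n - X l) \<le> 4 / c * (1 / real (Suc n) + 1 / real (Suc l))"
    for n l
  proof -
    define p where "p = (1 / 2) \<cdot>\<^sub>a (X n + X l)"
    define q where "q = (1 / 2) \<cdot>\<^sub>a (X n - X l)"
    have p: "p \<in> Ld2 G" unfolding p_def using X(1) by blast
    have eq: "X n - p = q" "X l - p = - q"
      by (simp_all add: p_def q_def arr_scale_def fun_eq_iff field_simps)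
    have "F p + Ld2_inner G (g p) q + c / 2 * Ld2_inner G q q \<le> F (X n)"
      using F[OF p X(1)[of n]] eq by simp
    moreover have "F p - Ld2_inner G (g p) q + c / 2 * Ld2_inner G q q \<le> F (X l)"
      using F[OF p X(1)[of l]] eq by (simp add: Ld2_inner_left Ld2_inner_right)
    ultimately have q_le: "c * Ld2_inner G q q \<le> 1 / real (Suc n) + 1 / real (Suc l)"
      using X(2)[of n] X(2)[of l] m_le[OF p] by linarith
    have "c * Ld2_inner G (X n - X l) (X n - X l) = 4 * (c * Ld2_inner G q q)"
      by (simp add: q_def Ld2_inner_left Ld2_inner_right field_simps)
    also have "\<dots> \<le> 4 * (1 / real (Suc n) + 1 / real (Suc l))"
      using q_le by (rule mult_left_mono) simp
    finally have "Ld2_inner G (X n - X l) (X n - X l) \<le>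
        4 * (1 / real (Suc n) + 1 / real (Suc l)) / c"
      by (simp only: pos_le_divide_eq[OF c] mult.commute)
    then show ?thesis by simp
  qed
  \<comment> \<open>The limit is taken cell by cell. Outside the box the sequence is constantly 0,
    so a limit exists there too and \<open>V\<close> lies in \<open>Ld2 G\<close>.\<close>
  define V :: arr where "V = (\<lambda>i j k. SOME v. (\<lambda>n. X n i j k) \<longlonglongrightarrow> v)"
  have "\<exists>v. (\<lambda>n. X n i j k) \<longlonglongrightarrow> v" for i j k
  proof (cases "(i, j, k) \<in> grid_box G")
    case True
    define w where "w = cell_weight G i j k"
    have w: "w > 0" unfolding w_def by (rule cell_weight_pos[OF ok])
    have "(X n i j k - X l i j k)\<^sup>2 \<le> (4 / c / w) * (1 / real (Suc n) + 1 / real (Suc l))" for n l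
    proof -
      have "w * (X n i j k - X l i j k)\<^sup>2 \<le> 4 / c * (1 / real (Suc n) + 1 / real (Suc l))"
        using cell_le_Ld2_inner_self[OF True, of "X n - X l"] X_close[of n l]
        by (simp add: w_def)
      then have "(X n i j k - X l i j k)\<^sup>2 \<le> 4 / c * (1 / real (Suc n) + 1 / real (Suc l)) / w"
        by (simp only: pos_le_divide_eq[OF w] mult.commute)
      then show ?thesis by simp
    qed
    then have "Cauchy (\<lambda>n. X n i j k)"
      by (rule Cauchy_if_power2_diff_le) (use c w in simp)
    then show ?thesis by (simp add: Cauchy_convergent_iff convergent_def)
  next
    case False
    then have "X n i j k = 0" for n using Ld2_outside[OF X(1)] by blast
    then show ?thesis by auto
  qed
  then have V: "(\<lambda>n. X n i j k) \<longlonglongrightarrow> V i j k" for i j k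
    unfolding V_def by (rule someI_ex)
  have V_in: "V \<in> Ld2 G"
  proof (rule Ld2I)
    fix i j k assume "(i, j, k) \<notin> grid_box G"
    then have "X n i j k = 0" for n using Ld2_outside[OF X(1)] by blast
    then show "V i j k = 0" using V[of i j k] by (simp add: LIMSEQ_const_iff)
  qed
  \<comment> \<open>The limit is left with \<open>V i j k - V i j k\<close> so that the limit rules
    apply termwise; it simplifies to 0 afterwards.\<close>
  have "(\<lambda>n. Ld2_inner G (g V) (X n - V)) \<longlonglongrightarrow>
      (\<Sum>(i, j, k)\<in>grid_box G. cell_weight G i j k * (g V i j k * (V i j k - V i j k)))"
    unfolding Ld2_inner_eq_sum[OF ok] case_prod_unfold fun_diff_def
    by (intro tendsto_intros V)
  then have "(\<lambda>n. F V + Ld2_inner G (g V) (X n - V)) \<longlonglongrightarrow> F V + 0"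
    by (intro tendsto_add tendsto_const) simp
  moreover have "(\<lambda>n. m + 1 / real (Suc n)) \<longlonglongrightarrow> m + 0"
    using LIMSEQ_inverse_real_of_nat by (intro tendsto_add tendsto_const) (simp add: inverse_eq_divide)
  moreover have "F V + Ld2_inner G (g V) (X n - V) \<le> m + 1 / real (Suc n)" for n
  proof -
    have "0 \<le> c / 2 * Ld2_inner G (X n - V) (X n - V)"
      using c Ld2_inner_self_nonneg by simp
    then show ?thesis using F[OF V_in X(1)[of n]] X(2)[of n] by linarith
  qed
  ultimately have "F V \<le> m" using LIMSEQ_le by fastforce
  then show thesis using that[OF V_in] m_le by force
qed

section \<open>The proximal equation\<close>

lemma strongly_convex_gradient_ineq:
  assumes "strongly_convex G \<mu> \<nu>" and "\<mu> \<ge> 0" and "a \<in> Ld2 G" and "b \<in> Ld2 G"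
  shows "\<nu> a + Ld2_inner G (grad G \<nu> a) (b - a) \<le> \<nu> b"
proof -
  have "0 \<le> \<mu> / 2 * (Ld2_norm G (b - a))\<^sup>2" using \<open>\<mu> \<ge> 0\<close> by simp
  moreover have "\<nu> b \<ge> \<nu> a + Ld2_inner G (grad G \<nu> a) (b - a) + \<mu> / 2 * (Ld2_norm G (b - a))\<^sup>2"
    using assms unfolding strongly_convex_def by blast
  ultimately show ?thesis by linarith
qed

text \<open>Says that the resolvent of \<open>grad G \<nu>\<close> with step \<open>t\<close> is
  defined and single-valued on \<open>Ld2 G\<close>: the solution is the proximal point of
  \<open>W\<close>.\<close>

lemma proximal_equation_unique_solution:
  assumes \<nu>: "strongly_convex G \<mu> \<nu>" and \<mu>: "\<mu> \<ge> 0" and t: "t > 0" and W: "W \<in> Ld2 G"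
  shows "\<exists>!V. V \<in> Ld2 G \<and> (1 / t) \<cdot>\<^sub>a (V - W) + grad G \<nu> V = 0"
proof (rule ex_ex1I)
  let ?I = "Ld2_inner G"
  have ex: "grad_exists G \<nu> f" if "f \<in> Ld2 G" for f
    using \<nu> that by (simp add: strongly_convex_def)
  note convex = strongly_convex_gradient_ineq[OF \<nu> \<mu>]
  define F where "F = (\<lambda>V. \<nu> V + 1 / (2 * t) * ?I (V - W) (V - W))"
  \<comment> \<open>\<open>r\<close> is the gradient that \<open>F\<close> should have. The exact
    expansion \<open>quad\<close> gives the strong convexity inequality for \<open>F\<close> with
    slope \<open>r\<close> and constant \<open>1 / t\<close>.\<close>
  define r where "r = (\<lambda>V. (1 / t) \<cdot>\<^sub>a (V - W) + grad G \<nu> V)"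
  have quad: "?I (b - W) (b - W) = ?I (a - W) (a - W) + 2 * ?I (a - W) (b - a) + ?I (b - a) (b - a)"
    for a b
    by (simp add: Ld2_inner_left Ld2_inner_right Ld2_inner_commute)
  have "F a + ?I (r a) (b - a) + (1 / t) / 2 * ?I (b - a) (b - a) \<le> F b"
    if "a \<in> Ld2 G" "b \<in> Ld2 G" for a b
  proof -
    have "?I (r a) (b - a) = 1 / t * ?I (a - W) (b - a) + ?I (grad G \<nu> a) (b - a)"
      unfolding r_def by (simp only: Ld2_inner_add_left Ld2_inner_scale_left)
    moreover have quad_scaled: "1 / (2 * t) * (x + 2 * y + z) = 1 / (2 * t) * x + 1 / t * y + 1 / t / 2 * z"
      for x y z :: real
      using t by (simp add: field_simps)
    ultimately show ?thesis
      using convex[OF that] unfolding F_def quad[of b a] quad_scaled by linarith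
  qed
  then obtain V where V: "V \<in> Ld2 G" and min: "\<And>h. h \<in> Ld2 G \<Longrightarrow> F V \<le> F h"
    using Ld2_strongly_convex_attains_min[of "1 / t" F r] t by auto
  \<comment> \<open>Directional derivatives are limits from the right, so minimality yields an
    inequality in each direction; the direction \<open>- r V\<close> then forces
    \<open>r V = 0\<close>.\<close>
  have r_nonneg: "0 \<le> ?I (r V) h" if h: "h \<in> Ld2 G" for h
  proof -
    have "((\<lambda>s. (\<nu> (V + s \<cdot>\<^sub>a h) - \<nu> V) / s) \<longlongrightarrow> ?I (grad G \<nu> V) h) (at_right 0)"
      using has_dir_deriv_grad[OF ex[OF V] h] by (simp add: has_dir_deriv_def)
    moreover have "((\<lambda>s. - (1 / t) * ?I (V - W) h - s * (?I h h / (2 * t))) \<longlongrightarrow>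
        - (1 / t) * ?I (V - W) h - 0 * (?I h h / (2 * t))) (at_right 0)"
      by (intro tendsto_intros)
    \<comment> \<open>Minimality of \<open>V\<close> for \<open>F\<close>, with the quadratic part
      expanded and moved to the left, bounds the difference quotient of \<open>\<nu>\<close> alone
      from below.\<close>
    moreover have "- (1 / t) * ?I (V - W) h - s * (?I h h / (2 * t)) \<le> (\<nu> (V + s \<cdot>\<^sub>a h) - \<nu> V) / s"
      if "s > 0" for s
    proof -
      have "F V \<le> F (V + s \<cdot>\<^sub>a h)" using min V h by blast
      then have "- (1 / (2 * t)) * (2 * s * ?I (V - W) h + s * s * ?I h h) \<le> \<nu> (V + s \<cdot>\<^sub>a h) - \<nu> V"
        by (simp add: F_def quad[of "V + s \<cdot>\<^sub>a h" V] Ld2_inner_left(4) Ld2_inner_right(4)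
            algebra_simps add_divide_distrib)
      moreover have "- (1 / (2 * t)) * (2 * s * ?I (V - W) h + s * s * ?I h h) =
          (- (1 / t) * ?I (V - W) h - s * (?I h h / (2 * t))) * s"
        using t by (simp add: field_simps)
      ultimately show ?thesis using that by (simp add: pos_le_divide_eq)
    qed
    then have "eventually (\<lambda>s. - (1 / t) * ?I (V - W) h - s * (?I h h / (2 * t))
        \<le> (\<nu> (V + s \<cdot>\<^sub>a h) - \<nu> V) / s) (at_right 0)"
      by (simp add: eventually_at_right_less eventually_mono[OF eventually_at_right_less])
    ultimately have "- (1 / t) * ?I (V - W) h - 0 * (?I h h / (2 * t)) \<le> ?I (grad G \<nu> V) h"
      by (intro tendsto_le[OF trivial_limit_at_right_real])
    then show ?thesis
      by (simp add: r_def Ld2_inner_add_left Ld2_inner_scale_left)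
  qed
  have r_in: "r V \<in> Ld2 G"
    unfolding r_def using V W grad_in_Ld2[OF ex[OF V]] by blast
  have "?I (r V) (r V) \<le> 0"
    using r_nonneg[of "- r V"] r_in by (auto simp: Ld2_inner_right(3))
  then have "r V = 0" using Ld2_inner_self_le_0_iff[OF r_in] by simp
  then show "\<exists>V. V \<in> Ld2 G \<and> (1 / t) \<cdot>\<^sub>a (V - W) + grad G \<nu> V = 0"
    using V by (auto simp: r_def)
next
  let ?I = "Ld2_inner G"
  fix V V'
  assume *: "V \<in> Ld2 G \<and> (1 / t) \<cdot>\<^sub>a (V - W) + grad G \<nu> V = 0"
    and **: "V' \<in> Ld2 G \<and> (1 / t) \<cdot>\<^sub>a (V' - W) + grad G \<nu> V' = 0"
  \<comment> \<open>Monotonicity of the gradient: the two gradient inequalities, with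
    \<open>V\<close> and \<open>V'\<close> exchanged, are added and the values of
    \<open>\<nu>\<close> cancel.\<close>
  have "?I (grad G \<nu> V) (V' - V) + ?I (grad G \<nu> V') (V - V') \<le> 0"
    using strongly_convex_gradient_ineq[OF \<nu> \<mu>, of V V']
      strongly_convex_gradient_ineq[OF \<nu> \<mu>, of V' V] * ** by linarith
  moreover have "?I (grad G \<nu> X) h = - (1 / t) * ?I (X - W) h"
    if "(1 / t) \<cdot>\<^sub>a (X - W) + grad G \<nu> X = 0" for X h
  proof -
    have "grad G \<nu> X = - ((1 / t) \<cdot>\<^sub>a (X - W))"
      using that by (simp only: eq_neg_iff_add_eq_0 add.commute)
    then show ?thesis by (simp only: Ld2_inner_left(3,4) mult_minus_left)
  qed
  note this[OF conjunct2[OF *]] this[OF conjunct2[OF **]]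
  \<comment> \<open>After the gradients are replaced by means of the equation, \<open>W\<close>
    cancels and the monotonicity expression becomes exactly this square.\<close>
  ultimately have "1 / t * ?I (V - V') (V - V') \<le> 0"
    by (simp add: Ld2_inner_left Ld2_inner_right algebra_simps diff_divide_distrib)
  then have "?I (V - V') (V - V') \<le> 0" using t by (simp add: divide_le_0_iff)
  then show "V = V'" using Ld2_inner_self_le_0_iff[of "V - V'"] * ** by auto
qed

end

section \<open>Reduction of the scheme to the proximal equation\<close>

theorem theorem3p1:
  fixes G :: grid and \<nu>1 \<nu>2 \<nu>3 :: "arr \<Rightarrow> real" and L \<mu>2 \<mu>3 \<Delta>t :: real
  assumes "grid_ok G"
    and "L > 0" and "L_smooth G L \<nu>1"
    and "strongly_convex G \<mu>2 \<nu>2" and "strongly_convex G \<mu>3 \<nu>3" and "\<mu>2 \<ge> 0"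
    and "\<Delta>t > 0"
  shows "\<forall>U\<in>Ld2 G. \<exists>!V. V \<in> Ld2 G \<and>
    (1 / \<Delta>t) \<cdot>\<^sub>a (V - U) = - (grad G \<nu>1 U + grad G \<nu>2 V - grad G \<nu>3 U)"
proof
  fix U assume U: "U \<in> Ld2 G"
  have "grad_exists G \<nu>1 U" "grad_exists G \<nu>3 U"
    using assms U by (auto simp: L_smooth_def strongly_convex_def)
  then have "grad G \<nu>1 U \<in> Ld2 G" "grad G \<nu>3 U \<in> Ld2 G"
    using grad_in_Ld2[OF \<open>grid_ok G\<close>] by blast+
  \<comment> \<open>\<open>W\<close> is an explicit step from \<open>U\<close> with the two
    gradients evaluated at the old iterate, so only the implicit gradient of \<open>\<nu>2\<close>
    is left in the equation.\<close>
  define W where "W = U - \<Delta>t \<cdot>\<^sub>a (grad G \<nu>1 U - grad G \<nu>3 U)"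
  have "W \<in> Ld2 G"
    unfolding W_def using U \<open>grad G \<nu>1 U \<in> Ld2 G\<close> \<open>grad G \<nu>3 U \<in> Ld2 G\<close> by blast
  then have "\<exists>!V. V \<in> Ld2 G \<and> (1 / \<Delta>t) \<cdot>\<^sub>a (V - W) + grad G \<nu>2 V = 0"
    by (rule proximal_equation_unique_solution
        [OF \<open>grid_ok G\<close> \<open>strongly_convex G \<mu>2 \<nu>2\<close> \<open>\<mu>2 \<ge> 0\<close> \<open>\<Delta>t > 0\<close>])
  moreover have "(1 / \<Delta>t) \<cdot>\<^sub>a (V - U) = - (grad G \<nu>1 U + grad G \<nu>2 V - grad G \<nu>3 U) \<longleftrightarrow>
      (1 / \<Delta>t) \<cdot>\<^sub>a (V - W) + grad G \<nu>2 V = 0" for V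
  proof -
    have "(1 / \<Delta>t) \<cdot>\<^sub>a (V - W) = (1 / \<Delta>t) \<cdot>\<^sub>a (V - U) + (grad G \<nu>1 U - grad G \<nu>3 U)"
      using \<open>\<Delta>t > 0\<close> by (simp add: W_def arr_scale_def fun_eq_iff field_simps)
    then have "(1 / \<Delta>t) \<cdot>\<^sub>a (V - W) + grad G \<nu>2 V =
        (1 / \<Delta>t) \<cdot>\<^sub>a (V - U) + (grad G \<nu>1 U + grad G \<nu>2 V - grad G \<nu>3 U)"
      by simp
    then show ?thesis by (simp only: eq_neg_iff_add_eq_0)
  qed
  ultimately show "\<exists>!V. V \<in> Ld2 G \<and>
    (1 / \<Delta>t) \<cdot>\<^sub>a (V - U) = - (grad G \<nu>1 U + grad G \<nu>2 V - grad G \<nu>3 U)" by simp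
qed

end
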